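(* Let $S$ be an $AG^{*}$-groupoid. Then $S$ is a paramedial AG-groupoid, i.e. $(ab)(cd)=(db)(ca)$ for all $a,b,c,d\in S$.
   Context: A groupoid is a set $S$ with a binary operation, written as juxtaposition; no associativity or commutativity is assumed. An AG-groupoid is a groupoid $S$ satisfying the left invertive law $(ab)c=(cb)a$ for all $a,b,c\in S$. An $AG^{*}$-groupoid is an AG-groupoid satisfying $(ab)c=b(ac)$ for all $a,b,c\in S$. A paramedial AG-groupoid is an AG-groupoid satisfying the paramedial law $(ab)(cd)=(db)(ca)$ for all $a,b,c,d\in S$. *)

theory Defs
  imports Main
begin

(* A groupoid here is a carrier set closed under a binary operation (a magma), not a category
   whose morphisms are invertible.  The laws are required on the carrier only. *)
locale groupoid =
  fixes S :: "'a set" and mult :: "'a \<Rightarrow> 'a \<Rightarrow> 'a"  (infixl "\<cdot>" 70)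
  assumes closed: "a \<in> S \<Longrightarrow> b \<in> S \<Longrightarrow> a \<cdot> b \<in> S"

locale AG_groupoid = groupoid +
  assumes left_invertive:
    "a \<in> S \<Longrightarrow> b \<in> S \<Longrightarrow> c \<in> S \<Longrightarrow> (a \<cdot> b) \<cdot> c = (c \<cdot> b) \<cdot> a"

locale AG_star_groupoid = AG_groupoid +
  assumes star:
    "a \<in> S \<Longrightarrow> b \<in> S \<Longrightarrow> c \<in> S \<Longrightarrow> (a \<cdot> b) \<cdot> c = b \<cdot> (a \<cdot> c)"

locale paramedial_AG_groupoid = AG_groupoid +
  assumes paramedial:
    "a \<in> S \<Longrightarrow> b \<in> S \<Longrightarrow> c \<in> S \<Longrightarrow> d \<in> S \<Longrightarrow>
      (a \<cdot> b) \<cdot> (c \<cdot> d) = (d \<cdot> b) \<cdot> (c \<cdot> a)"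

end

theory Submission
  imports Defs
begin

text \<open>The left invertive law alone gives the medial law, which swaps the two inner factors of
  (ab)(cd). The star law adds two more moves: the factors inside the right factor of a product may
  be swapped, and (ab)(cd) = (dc)(ab). Applying the latter, then swapping ab to ba, then applying
  \<open>medial\<close> turns (ab)(cd) into (db)(ca).\<close>

context AG_groupoid
begin

text \<open>Left invertivity moves a outside, exchanges b and c within the remaining triple product,
  and brings a back.\<close>

lemma medial:
  assumes "a \<in> S" "b \<in> S" "c \<in> S" "d \<in> S"
  shows "(a \<cdot> b) \<cdot> (c \<cdot> d) = (a \<cdot> c) \<cdot> (b \<cdot> d)"
proof -
  have "(a \<cdot> b) \<cdot> (c \<cdot> d) = ((c \<cdot> d) \<cdot> b) \<cdot> a"
    using assms by (intro left_invertive closed)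
  also have "\<dots> = ((b \<cdot> d) \<cdot> c) \<cdot> a"
    using assms left_invertive[of c d b] by simp
  also have "\<dots> = (a \<cdot> c) \<cdot> (b \<cdot> d)"
    using assms by (intro left_invertive closed)
  finally show ?thesis .
qed

end

context AG_star_groupoid
begin

text \<open>By \<open>star\<close> the two sides are (ax)b and (bx)a, which
  \<open>left_invertive\<close> identifies.\<close>

lemma right_factor_commute:
  assumes "a \<in> S" "b \<in> S" "x \<in> S"
  shows "x \<cdot> (a \<cdot> b) = x \<cdot> (b \<cdot> a)"
  using assms by (metis left_invertive star)

lemma product_commute:
  assumes "a \<in> S" "b \<in> S" "c \<in> S" "d \<in> S"
  shows "(d \<cdot> c) \<cdot> (a \<cdot> b) = (a \<cdot> b) \<cdot> (c \<cdot> d)"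
proof -
  have "(d \<cdot> c) \<cdot> (a \<cdot> b) = ((a \<cdot> b) \<cdot> c) \<cdot> d"
    using assms by (intro left_invertive closed)
  also have "\<dots> = (b \<cdot> (a \<cdot> c)) \<cdot> d"
    using assms by (simp add: star)
  \<comment> \<open>Here \<open>star\<close> is used with the product ac as its middle
    factor.\<close>
  also have "\<dots> = (a \<cdot> c) \<cdot> (b \<cdot> d)"
    using assms by (intro star closed)
  also have "\<dots> = (a \<cdot> b) \<cdot> (c \<cdot> d)"
    using assms by (intro medial)
  finally show ?thesis .
qed

lemma paramedial:
  assumes "a \<in> S" "b \<in> S" "c \<in> S" "d \<in> S"
  shows "(a \<cdot> b) \<cdot> (c \<cdot> d) = (d \<cdot> b) \<cdot> (c \<cdot> a)"
proof -
  have "(a \<cdot> b) \<cdot> (c \<cdot> d) = (d \<cdot> c) \<cdot> (a \<cdot> b)"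
    using assms by (intro product_commute[symmetric])
  also have "\<dots> = (d \<cdot> c) \<cdot> (b \<cdot> a)"
    using assms by (intro right_factor_commute closed)
  also have "\<dots> = (d \<cdot> b) \<cdot> (c \<cdot> a)"
    using assms by (intro medial)
  finally show ?thesis .
qed

end

theorem corollary7:
  fixes S :: "'a set" and mult :: "'a \<Rightarrow> 'a \<Rightarrow> 'a"
  assumes "AG_star_groupoid S mult"
  shows "paramedial_AG_groupoid S mult"
proof -
  interpret AG_star_groupoid S mult by (fact assms)
  show ?thesis
    by unfold_locales (fact paramedial)
qed

end
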